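(* Let $\lambda>0$, $\mu>0$, $\nu\ge1$, and let $S:[0,1]\to[0,1]$ be the piecewise fractional linear map of type $(-,+,+)$ on the partition $0<\frac13<\frac12<1$ with inverse branches $$V_\lambda x=\frac{1-x}{3+(\lambda-3)x},\quad V_\mu x=\frac{1+(\mu-1)x}{3+(2\mu-3)x},\quad V_\nu x=\frac{1+(\nu-1)x}{2+(\nu-2)x},$$ with dual branches $$V^*_\lambda y=\frac{\lambda-3-y}{3+y},\quad V^*_\mu y=\frac{2\mu-3+(\mu-1)y}{3+y},\quad V^*_\nu y=\frac{\nu-2+(\nu-1)y}{2+y}.$$ Let $\eta$ be a fixed point of $V^*_\nu$, i.e. $\eta=-1$ or $\eta=\nu-2$, and let $\xi=\frac{\mu-4+\sqrt{\mu^2+4}}{2}$ be the rightmost fixed point of $V^*_\mu$. Suppose $V^*_\lambda\eta=V^*_\mu\eta$ and $V^*_\lambda\xi=V^*_\nu\xi$. If $\eta=-1$, then $\lambda=\mu$ and $\nu=1$. If $\eta=\nu-2$, then $\lambda=\mu\nu$; in this case $S$ is a $1$-step extension if $\mu=1$ (and therefore $\lambda=\nu$). In both cases $S$ has an exceptional dual, and the density of its invariant measure is (up to a multiplicative constant) $$g(x)=\frac{1}{(1+(\nu-2)x)(1+\xi x)}.$$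
   Context: The map $S$ is defined on the interior of each cylinder $B(k)=V_k[0,1]$ ($k\in\{\lambda,\mu,\nu\}$; these are $[0,\frac13],[\frac13,\frac12],[\frac12,1]$ respectively) as the inverse of $V_k$. Type $(-,+,+)$ means that $V_\lambda$ is decreasing and $V_\mu,V_\nu$ are increasing. Density of the invariant measure: a positive measurable function $g$ on $(0,1)$ with $g(x)=\sum_{k}g(V_kx)\,|V_k'(x)|$, understood up to a multiplicative constant. Dual: for $V_kx=\frac{c_k+d_kx}{a_k+b_kx}$ the adjoint branch is $V^*_ky=\frac{b_k+d_ky}{a_k+c_ky}$. A dual map of $S$ is a piecewise fractional linear map $S^*:B^*\to B^*$ on an interval $B^*$ whose inverse branches are the $V_k^*$ (so that the intervals $V_k^*B^*$ have disjoint interiors and together cover $B^*$). The dual is called natural if there is a map $\psi(t)=\frac{B+Dt}{A+Bt}$ with $\psi\circ V_k=V_k^*\circ\psi$ for all $k$, and exceptional otherwise. The degenerate case in which $B^*$ shrinks to a single point fixed by all $V_k^*$ may be regarded both as a natural and as an exceptional dual. $1$-step extension: given a piecewise fractional linear map $T:[0,1]\to[0,1]$ with partition $0<\frac12<1$ and two inverse branches, each mapping $[0,1]$ onto one of the two cylinders $[0,\frac12],[\frac12,1]$, choose one cylinder $B(\alpha)$ and let $B(\beta)$ be the other one. The map equal to $T^2$ on $B(\alpha)$ and equal to $T$ on $B(\beta)$, which has three branches, is called a $1$-step extension of $T$. A three-branch map is called a $1$-step extension if it arises in this way. *)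

theory Defs
  imports "HOL-Analysis.Analysis"
begin

section \<open>Fractional linear maps\<close>

text \<open>\<open>FL a b c d\<close> is the map \<open>x \<mapsto> (c + d x) / (a + b x)\<close>. As division by zero yields
  zero in HOL, the condition \<^term>\<open>fl_defined\<close> (no pole at the point) is stated wherever it matters.\<close>

datatype fl = FL real real real real

fun fl_app :: "fl \<Rightarrow> real \<Rightarrow> real" where
  "fl_app (FL a b c d) x = (c + d * x) / (a + b * x)"

fun fl_defined :: "fl \<Rightarrow> real \<Rightarrow> bool" where
  "fl_defined (FL a b c d) x \<longleftrightarrow> a + b * x \<noteq> 0"

fun fl_nondegenerate :: "fl \<Rightarrow> bool" where
  "fl_nondegenerate (FL a b c d) \<longleftrightarrow> a * d \<noteq> b * c"

fun fl_adjoint :: "fl \<Rightarrow> fl" where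
  "fl_adjoint (FL a b c d) = FL a c b d"


section \<open>Piecewise fractional linear maps\<close>

definition cylinder :: "real set \<Rightarrow> ('k \<Rightarrow> fl) \<Rightarrow> 'k \<Rightarrow> real set" where
  "cylinder B V k = fl_app (V k) ` B"

definition pfl_branches :: "real set \<Rightarrow> ('k::finite \<Rightarrow> fl) \<Rightarrow> bool" where
  "pfl_branches B V \<longleftrightarrow>
     is_interval B \<and> interior B \<noteq> {} \<and>
     (\<forall>k. fl_nondegenerate (V k) \<and> (\<forall>x\<in>B. fl_defined (V k) x)) \<and>
     (\<Union>k. cylinder B V k) = B \<and>
     (\<forall>j k. j \<noteq> k \<longrightarrow> interior (cylinder B V j) \<inter> interior (cylinder B V k) = {})"

text \<open>The values at the end points of the cylinders are arbitrary elements of \<open>B\<close>.\<close>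

definition pfl_map :: "real set \<Rightarrow> ('k::finite \<Rightarrow> fl) \<Rightarrow> (real \<Rightarrow> real) \<Rightarrow> bool" where
  "pfl_map B V F \<longleftrightarrow>
     pfl_branches B V \<and> F \<in> B \<rightarrow> B \<and>
     (\<forall>k. \<forall>x\<in>interior (cylinder B V k). F x = inv_into B (fl_app (V k)) x)"

definition invariant_density :: "('k::finite \<Rightarrow> fl) \<Rightarrow> (real \<Rightarrow> real) \<Rightarrow> bool" where
  "invariant_density V g \<longleftrightarrow>
     g \<in> borel_measurable (restrict_space borel {0<..<1}) \<and>
     (\<forall>x\<in>{0<..<1}. 0 < g x) \<and>
     (\<forall>x\<in>{0<..<1}. g x = (\<Sum>k\<in>UNIV. g (fl_app (V k) x) * \<bar>deriv (fl_app (V k)) x\<bar>))"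


section \<open>Dual maps\<close>

definition dual_map :: "('k::finite \<Rightarrow> fl) \<Rightarrow> real set \<Rightarrow> (real \<Rightarrow> real) \<Rightarrow> bool" where
  "dual_map V Bs Sd \<longleftrightarrow> pfl_map Bs (\<lambda>k. fl_adjoint (V k)) Sd"

text \<open>The identity \<open>\<psi> \<circ> V\<^sub>k = V\<^sub>k\<^sup>* \<circ> \<psi>\<close> is one between rational functions, so finitely many points
  (poles) are exempt. A constant \<open>\<psi>\<close> is not excluded: this makes exceptionality the stronger
  property, and it is what lets a one-point dual count as natural.\<close>

definition naturally_dual :: "('k::finite \<Rightarrow> fl) \<Rightarrow> bool" where
  "naturally_dual V \<longleftrightarrow>
     (\<exists>A B D. let \<psi> = FL A B B D in
        \<forall>k. finite {x\<in>{0..1}. \<not> (fl_defined (V k) x \<and> fl_defined \<psi> (fl_app (V k) x) \<and>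
                fl_defined \<psi> x \<and> fl_defined (fl_adjoint (V k)) (fl_app \<psi> x) \<and>
                fl_app \<psi> (fl_app (V k) x) = fl_app (fl_adjoint (V k)) (fl_app \<psi> x))})"

definition point_dual :: "('k::finite \<Rightarrow> fl) \<Rightarrow> real \<Rightarrow> bool" where
  "point_dual V p \<longleftrightarrow>
     (\<forall>k. fl_defined (fl_adjoint (V k)) p \<and> fl_app (fl_adjoint (V k)) p = p)"

text \<open>A dual that has shrunk to a point counts as exceptional (as well as natural).\<close>

definition has_exceptional_dual :: "('k::finite \<Rightarrow> fl) \<Rightarrow> bool" where
  "has_exceptional_dual V \<longleftrightarrow>
     (\<exists>Bs Sd. dual_map V Bs Sd \<and> \<not> naturally_dual V) \<or> (\<exists>p. point_dual V p)"


section \<open>The three-branch family\<close>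

datatype branch = Lam | Mu | Nu

lemma UNIV_branch: "(UNIV :: branch set) = {Lam, Mu, Nu}"
  by (auto intro: branch.exhaust)

instance branch :: finite
  by standard (simp add: UNIV_branch)

text \<open>The two branches of \<open>T\<close> are indexed by \<^typ>\<open>bool\<close>; \<open>\<alpha>\<close> is the index of the cylinder on
  which \<open>T\<close> is iterated. \<open>S\<close> and \<open>T\<close> are only compared inside the cylinders of \<open>S\<close>.\<close>

definition one_step_extension :: "(branch \<Rightarrow> fl) \<Rightarrow> (real \<Rightarrow> real) \<Rightarrow> bool" where
  "one_step_extension V S \<longleftrightarrow> pfl_map {0..1} V S \<and>
     (\<exists>(W :: bool \<Rightarrow> fl) T \<alpha>. pfl_map {0..1} W T \<and>
        cylinder {0..1} W False = {0..1/2} \<and> cylinder {0..1} W True = {1/2..1} \<and>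
        (\<forall>k. \<forall>x\<in>interior (cylinder {0..1} V k).
           S x = (if x \<in> cylinder {0..1} W \<alpha> then T (T x) else T x)))"

fun VS :: "real \<Rightarrow> real \<Rightarrow> real \<Rightarrow> branch \<Rightarrow> fl" where
  "VS lam mu nu Lam = FL 3 (lam - 3) 1 (- 1)"
| "VS lam mu nu Mu = FL 3 (2 * mu - 3) 1 (mu - 1)"
| "VS lam mu nu Nu = FL 2 (nu - 2) 1 (nu - 1)"

abbreviation VS_dual :: "real \<Rightarrow> real \<Rightarrow> real \<Rightarrow> branch \<Rightarrow> fl" where
  "VS_dual lam mu nu k \<equiv> fl_adjoint (VS lam mu nu k)"

lemma VS_app:
  "fl_app (VS lam mu nu Lam) x = (1 - x) / (3 + (lam - 3) * x)"
  "fl_app (VS lam mu nu Mu) x = (1 + (mu - 1) * x) / (3 + (2 * mu - 3) * x)"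
  "fl_app (VS lam mu nu Nu) x = (1 + (nu - 1) * x) / (2 + (nu - 2) * x)"
  by simp_all

lemma VS_dual_app:
  "fl_app (VS_dual lam mu nu Lam) y = (lam - 3 - y) / (3 + y)"
  "fl_app (VS_dual lam mu nu Mu) y = (2 * mu - 3 + (mu - 1) * y) / (3 + y)"
  "fl_app (VS_dual lam mu nu Nu) y = (nu - 2 + (nu - 1) * y) / (2 + y)"
  by simp_all


subsection \<open>The map is of type \<open>(-,+,+)\<close> on the partition \<open>0 < 1/3 < 1/2 < 1\<close>\<close>

lemma convex_pos:
  fixes p q x :: real
  assumes "0 < p" "0 < q" "0 \<le> x" "x \<le> 1"
  shows "0 < p + (q - p) * x"
proof -
  have eq: "p + (q - p) * x = p * (1 - x) + q * x" by (simp add: algebra_simps)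
  show ?thesis
  proof (cases "x = 0")
    case False
    then have "0 < q * x" "0 \<le> p * (1 - x)" using assms by auto
    then show ?thesis unfolding eq by linarith
  qed (use assms in simp)
qed

lemma VS_denominators:
  fixes lam mu nu x :: real
  assumes "lam > 0" "mu > 0" "nu \<ge> 1" "0 \<le> x" "x \<le> 1"
  shows "0 < 3 + (lam - 3) * x" "0 < 3 + (2 * mu - 3) * x" "0 < 2 + (nu - 2) * x"
  using convex_pos[of 3 lam x] convex_pos[of 3 "2 * mu" x] convex_pos[of 2 nu x] assms by auto

lemma cross_less:
  fixes a b c d :: real
  assumes "0 < b" "0 < d" "a * d < c * b"
  shows "a / b < c / d"
  using assms by (simp add: divide_less_eq less_divide_eq mult.commute)

lemma VS_monotone:
  fixes lam mu nu x y :: real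
  assumes "lam > 0" "mu > 0" "nu \<ge> 1" "0 \<le> x" "x < y" "y \<le> 1"
  shows "fl_app (VS lam mu nu Lam) y < fl_app (VS lam mu nu Lam) x"
    "fl_app (VS lam mu nu Mu) x < fl_app (VS lam mu nu Mu) y"
    "fl_app (VS lam mu nu Nu) x < fl_app (VS lam mu nu Nu) y"
proof -
  have d: "0 < 3 + (lam - 3) * x" "0 < 3 + (2 * mu - 3) * x" "0 < 2 + (nu - 2) * x"
    "0 < 3 + (lam - 3) * y" "0 < 3 + (2 * mu - 3) * y" "0 < 2 + (nu - 2) * y"
    using VS_denominators[of lam mu nu x] VS_denominators[of lam mu nu y] assms by auto
  have p: "0 < lam * (y - x)" "0 < mu * (y - x)" "0 < nu * (y - x)" using assms by auto
  have "(1 - x) * (3 + (lam - 3) * y) - (1 - y) * (3 + (lam - 3) * x) = lam * (y - x)"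
    by (simp add: algebra_simps)
  with p show "fl_app (VS lam mu nu Lam) y < fl_app (VS lam mu nu Lam) x"
    unfolding VS_app by (intro cross_less d) linarith
  have "(1 + (mu - 1) * y) * (3 + (2 * mu - 3) * x) - (1 + (mu - 1) * x) * (3 + (2 * mu - 3) * y)
      = mu * (y - x)"
    by (simp add: algebra_simps)
  with p show "fl_app (VS lam mu nu Mu) x < fl_app (VS lam mu nu Mu) y"
    unfolding VS_app by (intro cross_less d) linarith
  have "(1 + (nu - 1) * y) * (2 + (nu - 2) * x) - (1 + (nu - 1) * x) * (2 + (nu - 2) * y)
      = nu * (y - x)"
    by (simp add: algebra_simps)
  with p show "fl_app (VS lam mu nu Nu) x < fl_app (VS lam mu nu Nu) y"
    unfolding VS_app by (intro cross_less d) linarith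
qed

lemma VS_defined:
  assumes "lam > 0" "mu > 0" "nu \<ge> 1" "x \<in> {0..1}"
  shows "fl_defined (VS lam mu nu k) x"
  using VS_denominators[of lam mu nu x] assms by (cases k) auto

lemma VS_continuous:
  assumes "lam > 0" "mu > 0" "nu \<ge> 1"
  shows "continuous_on {0..1} (fl_app (VS lam mu nu k))"
proof -
  obtain a b c d where V: "VS lam mu nu k = FL a b c d" by (cases "VS lam mu nu k")
  have "\<forall>x\<in>{0..1}. a + b * x \<noteq> 0" using VS_defined[OF assms, of _ k] V by simp
  then have "continuous_on {0..1} (\<lambda>x. (c + d * x) / (a + b * x))"
    by (intro continuous_intros) auto
  moreover have "fl_app (VS lam mu nu k) = (\<lambda>x. (c + d * x) / (a + b * x))" using V by auto
  ultimately show ?thesis by simp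
qed

lemma VS_cylinders:
  assumes "lam > 0" "mu > 0" "nu \<ge> 1"
  shows "cylinder {0..1} (VS lam mu nu) Lam = {0..1/3}"
    "cylinder {0..1} (VS lam mu nu) Mu = {1/3..1/2}"
    "cylinder {0..1} (VS lam mu nu) Nu = {1/2..1}"
proof -
  have inc: "f ` {0..1} = {f 0..f 1}"
    if cont: "continuous_on {0..1} f" and
      mono: "\<And>x y. 0 \<le> x \<Longrightarrow> x < y \<Longrightarrow> y \<le> 1 \<Longrightarrow> f x < f y"
    for f :: "real \<Rightarrow> real"
  proof
    have "f 0 \<le> f x \<and> f x \<le> f 1" if "0 \<le> x" "x \<le> 1" for x
      using that mono[of 0 x] mono[of x 1]
      by (cases "x = 0"; cases "x = 1") auto
    then show "f ` {0..1} \<subseteq> {f 0..f 1}" by auto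
    show "{f 0..f 1} \<subseteq> f ` {0..1}"
    proof
      fix y assume "y \<in> {f 0..f 1}"
      then obtain x where "0 \<le> x" "x \<le> 1" "f x = y"
        using IVT'[of f 0 y 1] cont by auto
      then show "y \<in> f ` {0..1}" by auto
    qed
  qed
  define f where "f = fl_app (VS lam mu nu Lam)"
  have "(\<lambda>x. - f x) ` {0..1} = {- f 0..- f 1}"
    using VS_continuous[OF assms, of Lam] VS_monotone(1)[OF assms] unfolding f_def
    by (intro inc continuous_on_minus) auto
  then have "uminus ` (\<lambda>x. - f x) ` {0..1} = uminus ` {- f 0..- f 1}" by simp
  then have "f ` {0..1} = {f 1..f 0}" unfolding image_image by simp
  moreover have "f 0 = 1/3" "f 1 = 0" by (simp_all add: f_def)
  ultimately show "cylinder {0..1} (VS lam mu nu) Lam = {0..1/3}"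
    unfolding cylinder_def f_def by simp
  have "fl_app (VS lam mu nu Mu) 0 = 1/3" "fl_app (VS lam mu nu Mu) 1 = 1/2"
    using assms by (simp_all add: divide_simps)
  then show "cylinder {0..1} (VS lam mu nu) Mu = {1/3..1/2}"
    using inc[OF VS_continuous[OF assms, of Mu] VS_monotone(2)[OF assms]]
    unfolding cylinder_def by simp
  have "fl_app (VS lam mu nu Nu) 0 = 1/2" "fl_app (VS lam mu nu Nu) 1 = 1"
    using assms by (simp_all add: divide_simps)
  then show "cylinder {0..1} (VS lam mu nu) Nu = {1/2..1}"
    using inc[OF VS_continuous[OF assms, of Nu] VS_monotone(3)[OF assms]]
    unfolding cylinder_def by simp
qed

lemma VS_pfl_branches:
  assumes "lam > 0" "mu > 0" "nu \<ge> 1"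
  shows "pfl_branches {0..1} (VS lam mu nu)"
proof -
  have "fl_nondegenerate (VS lam mu nu k)" for k
    using assms by (cases k) (auto simp: algebra_simps)
  moreover have "(\<Union>k. cylinder {0..1} (VS lam mu nu) k) = {0..1}"
    using VS_cylinders[OF assms] by (auto simp: UNIV_branch)
  moreover have "interior (cylinder {0..1} (VS lam mu nu) j) \<inter>
      interior (cylinder {0..1} (VS lam mu nu) k) = {}" if "j \<noteq> k" for j k
    using that VS_cylinders[OF assms]
    by (cases j; cases k) (auto simp: interior_atLeastAtMost_real)
  ultimately show ?thesis
    unfolding pfl_branches_def using VS_defined[OF assms]
    by (auto simp: interior_atLeastAtMost_real is_interval_cc)
qed

lemma VS_map_exists:
  assumes "lam > 0" "mu > 0" "nu \<ge> 1"
  shows "\<exists>S. pfl_map {0..1} (VS lam mu nu) S"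
proof -
  let ?V = "VS lam mu nu" and ?C = "cylinder {0..1} (VS lam mu nu)"
  define S where "S x = (if \<exists>k. x \<in> interior (?C k)
    then inv_into {0..1} (fl_app (?V (THE k. x \<in> interior (?C k)))) x else 0)" for x
  note br = VS_pfl_branches[OF assms]
  have S: "S x = inv_into {0..1} (fl_app (?V k)) x" if x: "x \<in> interior (?C k)" for x k
  proof -
    have "(THE k. x \<in> interior (?C k)) = k"
      using x br unfolding pfl_branches_def by (intro the_equality) blast+
    then show ?thesis using x unfolding S_def by auto
  qed
  have "S x \<in> {0..1}" for x
  proof (cases "\<exists>k. x \<in> interior (?C k)")
    case True
    then obtain k where k: "x \<in> interior (?C k)" by blast
    then have "x \<in> fl_app (?V k) ` {0..1}" using interior_subset unfolding cylinder_def by blast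
    then show ?thesis unfolding S[OF k] by (rule inv_into_into)
  qed (simp add: S_def)
  then show ?thesis using br S unfolding pfl_map_def by blast
qed


subsection \<open>Fixed points of the dual branches\<close>

lemma VS_dual_fixed_points_Nu:
  "fl_app (VS_dual lam mu nu Nu) y = y \<longleftrightarrow> y = - 1 \<or> y = nu - 2" if "nu \<ge> 1"
proof (cases "2 + y = 0")
  case False
  then have "fl_app (VS_dual lam mu nu Nu) y = y \<longleftrightarrow> nu - 2 + (nu - 1) * y = y * (2 + y)"
    unfolding VS_dual_app by (simp add: divide_eq_eq)
  also have "\<dots> \<longleftrightarrow> (y + 1) * (y - (nu - 2)) = 0" by (auto simp: algebra_simps)
  finally show ?thesis by auto
next
  case True
  then have "y = - 2" by simp
  with that show ?thesis by simp
qed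

lemma VS_dual_rightmost_fixed_point_Mu:
  fixes mu :: real
  assumes "mu > 0"
  defines "\<xi> \<equiv> (mu - 4 + sqrt (mu\<^sup>2 + 4)) / 2"
  shows "fl_app (VS_dual lam mu nu Mu) \<xi> = \<xi>"
    and "3 + y \<noteq> 0 \<Longrightarrow> fl_app (VS_dual lam mu nu Mu) y = y \<Longrightarrow> y \<le> \<xi>"
proof -
  define s where "s = sqrt (mu\<^sup>2 + 4)"
  have s2: "s * s = mu\<^sup>2 + 4" and s0: "0 \<le> s" by (simp_all add: s_def)
  have x: "\<xi> = (mu - 4 + s) / 2" unfolding \<xi>_def s_def ..
  have eq: "fl_app (VS_dual lam mu nu Mu) y = y \<longleftrightarrow> (2 * y + 4 - mu)\<^sup>2 = s * s"
    if "3 + y \<noteq> 0" for y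
  proof -
    have "fl_app (VS_dual lam mu nu Mu) y = y \<longleftrightarrow> 2 * mu - 3 + (mu - 1) * y = y * (3 + y)"
      unfolding VS_dual_app using that by (simp add: divide_eq_eq)
    also have "\<dots> \<longleftrightarrow> (2 * y + 4 - mu)\<^sup>2 = s * s"
      unfolding s2 by (auto simp: power2_eq_square algebra_simps)
    finally show ?thesis .
  qed
  have "3 + \<xi> \<noteq> 0" using assms(1) s0 x by (simp add: field_simps)
  then show "fl_app (VS_dual lam mu nu Mu) \<xi> = \<xi>"
  proof -
    have "2 * \<xi> + 4 - mu = s" using x by simp
    then show ?thesis using eq[OF \<open>3 + \<xi> \<noteq> 0\<close>] by (simp only: power2_eq_square)
  qed
  assume "3 + y \<noteq> 0" "fl_app (VS_dual lam mu nu Mu) y = y"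
  then have "(2 * y + 4 - mu)\<^sup>2 = s\<^sup>2" using eq by (simp add: power2_eq_square)
  then have "2 * y + 4 - mu \<le> s" using s0 by (metis power2_le_imp_le order_refl)
  then show "y \<le> \<xi>" using x by simp
qed

end

theory Submission
  imports Defs
begin

text \<open>
  With \<open>t = \<xi> + 2\<close> the fixed-point equation of \<open>V\<^sub>\<mu>\<^sup>*\<close> reads \<open>t\<^sup>2 = 1 + \<mu> t\<close>, and each of the
  two coincidence conditions amounts to \<open>\<lambda> = \<mu> \<nu>\<close> (or to \<open>\<lambda> = \<mu>\<close> at \<open>-1\<close>). The dual branches
  then split the segment between \<open>\<nu> - 2\<close> and \<open>\<xi>\<close> at the two points
  \<open>V\<^sub>\<lambda>\<^sup>* \<xi> = V\<^sub>\<nu>\<^sup>* \<xi>\<close> and \<open>V\<^sub>\<lambda>\<^sup>* (\<nu> - 2) = V\<^sub>\<mu>\<^sup>* (\<nu> - 2)\<close>. Integrating \<open>(1 + x y)\<^sup>-\<^sup>2\<close> over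
  this segment gives the density, and invariance is the additivity of that integral. A map
  \<open>\<psi>\<close> as in a natural dual gives a symmetric matrix whose product with the matrix of each
  branch is again symmetric, because the traces do not vanish; this is a homogeneous linear
  system of determinant \<open>\<mu> (\<mu> \<nu> - \<nu>\<^sup>2 + 1)\<close> up to sign, which vanishes only if the segment is a point.
\<close>

section \<open>Fractional linear maps\<close>

lemma fl_inj_on:
  assumes "fl_nondegenerate V" and "\<And>x. x \<in> B \<Longrightarrow> fl_defined V x"
  shows "inj_on (fl_app V) B"
proof (rule inj_onI)
  obtain a b c d where V: "V = FL a b c d" by (cases V)
  fix x y assume xy: "x \<in> B" "y \<in> B" "fl_app V x = fl_app V y"
  then have "a + b * x \<noteq> 0" "a + b * y \<noteq> 0" using assms(2) V by auto
  with xy(3) have "(c + d * x) * (a + b * y) = (c + d * y) * (a + b * x)"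
    unfolding V by (simp add: frac_eq_eq)
  then have "(a * d - b * c) * (x - y) = 0" by (simp add: algebra_simps)
  with assms(1) V show "x = y" by simp
qed

lemma fl_continuous_on:
  assumes "\<And>x. x \<in> B \<Longrightarrow> fl_defined V x"
  shows "continuous_on B (fl_app V)"
proof -
  obtain a b c d where V: "V = FL a b c d" by (cases V)
  have "continuous_on B (\<lambda>x. (c + d * x) / (a + b * x))"
    using assms unfolding V by (intro continuous_intros) auto
  moreover have "fl_app V = (\<lambda>x. (c + d * x) / (a + b * x))" using V by auto
  ultimately show ?thesis by simp
qed

lemma fl_image_closed_segment:
  assumes "fl_nondegenerate V" and "\<And>x. x \<in> closed_segment u v \<Longrightarrow> fl_defined V x"
  shows "fl_app V ` closed_segment u v = closed_segment (fl_app V u) (fl_app V v)"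
  using assms by (intro continuous_injective_image_segment_1 fl_continuous_on fl_inj_on) auto

lemma fl_deriv:
  assumes "a + b * x \<noteq> 0"
  shows "deriv (fl_app (FL a b c d)) x = (a * d - b * c) / (a + b * x)\<^sup>2"
proof -
  have eq: "fl_app (FL a b c d) = (\<lambda>x. (c + d * x) / (a + b * x))" by auto
  have "((\<lambda>x. (c + d * x) / (a + b * x)) has_real_derivative
      (d * (a + b * x) - (c + d * x) * b) / ((a + b * x) * (a + b * x))) (at x)"
    by (rule DERIV_divide) (use assms in \<open>auto intro!: derivative_eq_intros\<close>)
  moreover have "d * (a + b * x) - (c + d * x) * b = a * d - b * c" by (simp add: algebra_simps)
  ultimately show ?thesis unfolding eq power2_eq_square by (metis DERIV_imp_deriv)
qed

lemma pfl_map_exists: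
  assumes "pfl_branches B V"
  shows "\<exists>F. pfl_map B V F"
proof -
  let ?C = "cylinder B V"
  have "interior B \<noteq> {}" using assms by (simp add: pfl_branches_def)
  then obtain b where b: "b \<in> B" using interior_subset[of B] by blast
  \<comment> \<open>The cylinders have disjoint interiors, so the index is unique there; elsewhere
    \<open>b\<close> is a default that keeps the values in \<open>B\<close>.\<close>
  define F where "F x = (if \<exists>k. x \<in> interior (?C k)
    then inv_into B (fl_app (V (THE k. x \<in> interior (?C k)))) x else b)" for x
  have F: "F x = inv_into B (fl_app (V k)) x" if x: "x \<in> interior (?C k)" for x k
  proof -
    have "(THE k. x \<in> interior (?C k)) = k"
      using x assms unfolding pfl_branches_def by (intro the_equality) blast+
    then show ?thesis using x unfolding F_def by auto
  qed
  have "F x \<in> B" for x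
  proof (cases "\<exists>k. x \<in> interior (?C k)")
    case True
    then obtain k where k: "x \<in> interior (?C k)" by blast
    then have "x \<in> fl_app (V k) ` B" using interior_subset unfolding cylinder_def by blast
    then show ?thesis unfolding F[OF k] by (rule inv_into_into)
  qed (simp add: F_def b)
  then show ?thesis using assms F unfolding pfl_map_def by blast
qed

lemma pfl_map_branch:
  assumes "pfl_map B V F" and "y \<in> B" and "fl_app (V k) y \<in> interior (cylinder B V k)"
  shows "F (fl_app (V k) y) = y"
proof -
  have "inj_on (fl_app (V k)) B"
    using assms(1) unfolding pfl_map_def pfl_branches_def by (intro fl_inj_on) auto
  then show ?thesis using assms by (simp add: pfl_map_def)
qed


section \<open>Natural duals\<close>

lemma quadratic_coeffs_eq_0:
  fixes p q r :: real
  assumes "infinite {x. p + q * x + r * x\<^sup>2 = 0}"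
  shows "p = 0 \<and> q = 0 \<and> r = 0"
proof (rule ccontr)
  assume "\<not> ?thesis"
  then have "[:p, q, r:] \<noteq> 0" by auto
  then have "finite {x. poly [:p, q, r:] x = 0}" by (rule poly_roots_finite)
  moreover have "poly [:p, q, r:] x = p + q * x + r * x\<^sup>2" for x
    by (simp add: power2_eq_square algebra_simps)
  ultimately show False using assms by (simp only: not_False_eq_True)
qed

text \<open>The conclusion says that \<open>[[A, B], [B, D]] \<cdot> [[a, b], [c, d]]\<close> is symmetric. The other
  possibility, that it is antisymmetric, is excluded by the trace.\<close>

lemma natural_dual_symmetric:
  assumes nd: "a * d \<noteq> b * c" and tr: "a + d \<noteq> 0"
    and fin: "finite {x\<in>{0..1}. \<not> (fl_defined (FL a b c d) x
        \<and> fl_defined (FL A B B D) (fl_app (FL a b c d) x)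
        \<and> fl_defined (FL A B B D) x \<and> fl_defined (FL a c b d) (fl_app (FL A B B D) x)
        \<and> fl_app (FL A B B D) (fl_app (FL a b c d) x) = fl_app (FL a c b d) (fl_app (FL A B B D) x))}"
      (is "finite {x\<in>_. \<not> ?P x}")
  shows "B * a + D * c = A * b + B * d" and "A \<noteq> 0 \<or> B \<noteq> 0"
proof -
  let ?good = "{x\<in>{0..1}. ?P x}"
  have "infinite ({0..1} - {x\<in>{0..1}. \<not> ?P x})"
    using fin by (rule Diff_infinite_finite) (simp add: infinite_Icc)
  moreover have "{0..1} - {x\<in>{0..1}. \<not> ?P x} = ?good" by blast
  ultimately have inf: "infinite ?good" by simp
  then have "?good \<noteq> {}" by (metis finite.emptyI)
  then show "A \<noteq> 0 \<or> B \<noteq> 0" by auto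
  \<comment> \<open>Read by rows, \<open>[[r, p'], [p, q]]\<close> is the product matrix. It
    represents \<open>psi o V\<close>, and its transpose represents \<open>V* o psi\<close>;
    cross-multiplying gives a polynomial of degree at most two with infinitely many zeros.\<close>
  define p p' q r where "p = B * a + D * c" and "p' = A * b + B * d"
    and "q = B * b + D * d" and "r = A * a + B * c"
  have "(p - p') * r + (p\<^sup>2 - p'\<^sup>2) * x + (p - p') * q * x\<^sup>2 = 0" if "x \<in> ?good" for x
  proof -
    define M N where "M = a + b * x" and "N = A + B * x"
    have ne: "M \<noteq> 0" "N \<noteq> 0" using that by (auto simp: M_def N_def)
    have 1: "A + B * ((c + d * x) / M) = (r + p' * x) / M"
      using ne by (simp add: field_simps) (simp add: M_def r_def p'_def algebra_simps)
    have 2: "B + D * ((c + d * x) / M) = (p + q * x) / M"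
      using ne by (simp add: field_simps) (simp add: M_def p_def q_def algebra_simps)
    have 3: "a + c * ((B + D * x) / N) = (r + p * x) / N"
      using ne by (simp add: field_simps) (simp add: N_def r_def p_def algebra_simps)
    have 4: "b + d * ((B + D * x) / N) = (p' + q * x) / N"
      using ne by (simp add: field_simps) (simp add: N_def p'_def q_def algebra_simps)
    have "r + p' * x \<noteq> 0" "r + p * x \<noteq> 0"
      and "(p + q * x) / (r + p' * x) = (p' + q * x) / (r + p * x)"
      using that ne unfolding mem_Collect_eq fl_app.simps fl_defined.simps
        M_def[symmetric] N_def[symmetric] 1 2 3 4 by auto
    then have "(p + q * x) * (r + p * x) = (p' + q * x) * (r + p' * x)" by (simp add: frac_eq_eq)
    then show ?thesis by (simp add: power2_eq_square algebra_simps)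
  qed
  then have "?good \<subseteq> {x. (p - p') * r + (p\<^sup>2 - p'\<^sup>2) * x + (p - p') * q * x\<^sup>2 = 0}" by blast
  with inf have "infinite {x. (p - p') * r + (p\<^sup>2 - p'\<^sup>2) * x + (p - p') * q * x\<^sup>2 = 0}"
    using infinite_super by blast
  then have co: "(p - p') * r = 0" "p\<^sup>2 - p'\<^sup>2 = 0" "(p - p') * q = 0"
    using quadratic_coeffs_eq_0 by blast+
  have "p = p'"
  proof (rule ccontr)
    assume "p \<noteq> p'"
    with co have z: "r = 0" "q = 0" "p' = - p" by (auto simp: power2_eq_iff)
    \<comment> \<open>In the antisymmetric case the right-hand side vanishes, so the nonzero
      determinant and trace force \<open>B = 0\<close>.\<close>
    have "B * (a * d - b * c) * (a + d) = a * d * (p + p') - d * b * r - a * c * q"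
      unfolding p_def p'_def q_def r_def by (simp add: algebra_simps)
    with z nd tr have "B = 0" by simp
    with z nd tr have "D * c = 0 \<and> A * b = 0"
      unfolding p_def p'_def q_def r_def by (cases "a = 0") auto
    with \<open>B = 0\<close> \<open>p \<noteq> p'\<close> show False by (simp add: p_def p'_def)
  qed
  then show "B * a + D * c = A * b + B * d" by (simp add: p_def p'_def)
qed

text \<open>The condition \<open>ne\<close> says that \<open>nu\<close> is not a root of
  \<open>X^2 = 1 + mu X\<close>, that is, that the fixed points \<open>nu - 2\<close> and
  \<open>xi\<close> differ.\<close>

lemma VS_not_naturally_dual:
  assumes "mu > 0" and "nu \<ge> 1" and ne: "mu * nu \<noteq> nu\<^sup>2 - 1"
  shows "\<not> naturally_dual (VS (mu * nu) mu nu)"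
proof
  assume "naturally_dual (VS (mu * nu) mu nu)"
  then obtain A B D where nat: "\<And>k. finite {x\<in>{0..1}. \<not> (fl_defined (VS (mu * nu) mu nu k) x
      \<and> fl_defined (FL A B B D) (fl_app (VS (mu * nu) mu nu k) x)
      \<and> fl_defined (FL A B B D) x \<and> fl_defined (VS_dual (mu * nu) mu nu k) (fl_app (FL A B B D) x)
      \<and> fl_app (FL A B B D) (fl_app (VS (mu * nu) mu nu k) x)
        = fl_app (VS_dual (mu * nu) mu nu k) (fl_app (FL A B B D) x))}"
    unfolding naturally_dual_def Let_def by blast
  note natL = nat[of Lam, unfolded VS.simps fl_adjoint.simps]
    and natM = nat[of Mu, unfolded VS.simps fl_adjoint.simps]
    and natN = nat[of Nu, unfolded VS.simps fl_adjoint.simps]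
  have l: "B * 3 + D * 1 = A * (mu * nu - 3) + B * (- 1)"
    by (rule natural_dual_symmetric(1)[OF _ _ natL]) (use assms in auto)
  have AB: "A \<noteq> 0 \<or> B \<noteq> 0"
    by (rule natural_dual_symmetric(2)[OF _ _ natL]) (use assms in auto)
  have m: "B * 3 + D * 1 = A * (2 * mu - 3) + B * (mu - 1)"
    by (rule natural_dual_symmetric(1)[OF _ _ natM]) (use assms in auto)
  have n: "B * 2 + D * 1 = A * (nu - 2) + B * (nu - 1)"
    by (rule natural_dual_symmetric(1)[OF _ _ natN]) (use assms in auto)
  have e1: "A * (mu * nu - nu - 1) = B * (nu + 1)" using l n by (simp add: algebra_simps)
  have e2: "A * (2 * mu - nu - 1) + B * (mu - 1 - nu) = 0" using m n by (simp add: algebra_simps)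
  \<comment> \<open>Subtraction has removed \<open>D\<close>; this combination cancels
    \<open>B\<close> as in Cramer's rule and leaves \<open>A\<close> times the determinant.\<close>
  have "A * (mu * (mu * nu - nu\<^sup>2 + 1))
      = (nu + 1) * (A * (2 * mu - nu - 1) + B * (mu - 1 - nu))
        + (mu - 1 - nu) * (A * (mu * nu - nu - 1) - B * (nu + 1))"
    by (simp add: power2_eq_square algebra_simps)
  also have "\<dots> = 0" using e1 e2 by simp
  finally have "A = 0" using assms by simp
  with e1 assms AB show False by simp
qed


section \<open>The dual on the segment between the two fixed points\<close>

text \<open>Here \<open>t\<close> is \<open>xi + 2\<close>. From \<open>nu - 2\<close> to
  \<open>t - 2\<close> the pieces belong to \<open>Nu\<close>, \<open>Lam\<close>,
  \<open>Mu\<close>: the outer branches fix the two ends, and \<open>Lam\<close> reverses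
  orientation, so the gluing identities attach it to both neighbours. Either end may be the smaller
  one, hence \<open>closed_segment\<close>.\<close>

lemma VS_exceptional_dual:
  assumes mu: "mu > 0" and nu: "nu \<ge> 1" and t: "t > 1" and t2: "t\<^sup>2 = 1 + mu * t"
  shows "has_exceptional_dual (VS (mu * nu) mu nu)"
proof -
  let ?V = "VS (mu * nu) mu nu"
  let ?f = "\<lambda>k. fl_app (fl_adjoint (?V k))"
  have fix_Nu: "?f Nu (nu - 2) = nu - 2" using VS_dual_fixed_points_Nu[OF nu] by blast
  have fix_Mu: "?f Mu (t - 2) = t - 2"
    using t t2 by (simp add: field_simps power2_eq_square)
  have glue_eta: "?f Lam (nu - 2) = ?f Mu (nu - 2)"
    using nu by (simp add: field_simps)
  have glue_xi: "?f Lam (t - 2) = ?f Nu (t - 2)"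
  proof -
    have "(mu * nu - 3 - (t - 2)) * t - (nu - 2 + (nu - 1) * (t - 2)) * (t + 1)
        = nu * (1 + mu * t - t\<^sup>2)" by (simp add: power2_eq_square algebra_simps)
    then show ?thesis using t unfolding VS_dual_app t2 by (simp add: frac_eq_eq add.commute)
  qed
  show ?thesis
  proof (cases "t = nu")
    case True
    \<comment> \<open>The segment collapses to a common fixed point of all three dual
      branches.\<close>
    have "fl_defined (fl_adjoint (?V k)) (nu - 2)" for k
      using nu by (cases k) auto
    moreover have "?f k (nu - 2) = nu - 2" for k
      by (cases k) (use fix_Nu fix_Mu[unfolded True] glue_eta in \<open>simp_all only:\<close>)
    ultimately show ?thesis unfolding has_exceptional_dual_def point_dual_def by blast
  next
    case False
    have "mu * nu \<noteq> nu\<^sup>2 - 1"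
    proof
      assume *: "mu * nu = nu\<^sup>2 - 1"
      \<comment> \<open>Otherwise \<open>t\<close> and \<open>nu\<close> would be distinct roots of
        \<open>X^2 = 1 + mu X\<close>, whose product is -1, although both are positive.\<close>
      have "(t - nu) * (t * nu + 1) = nu * t\<^sup>2 - t * nu\<^sup>2 + t - nu"
        by (simp add: power2_eq_square algebra_simps)
      also have "\<dots> = nu * (1 + mu * t) - t * (mu * nu + 1) + t - nu" using t2 * by simp
      also have "\<dots> = 0" by (simp add: algebra_simps)
      finally have "t * nu + 1 = 0" using False by simp
      moreover have "t * nu > 0" using t nu by simp
      ultimately show False by simp
    qed
    then have nn: "\<not> naturally_dual ?V" by (rule VS_not_naturally_dual[OF mu nu])
    let ?B = "closed_segment (nu - 2) (t - 2)"
    have ge: "y \<ge> - 1" if "y \<in> ?B" for y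
      using that nu t by (auto simp: closed_segment_eq_real_ivl split: if_splits)
    have def: "fl_defined (fl_adjoint (?V k)) y" if "y \<in> ?B" for k y
      using ge[OF that] by (cases k) auto
    have nd: "fl_nondegenerate (fl_adjoint (?V k))" for k
      using mu nu by (cases k) (auto simp: algebra_simps)
    define m1 m2 where "m1 = ?f Nu (t - 2)" and "m2 = ?f Mu (nu - 2)"
    define C where "C = cylinder ?B (\<lambda>k. fl_adjoint (?V k))"
    have cyl: "C k = closed_segment (?f k (nu - 2)) (?f k (t - 2))" for k
      unfolding C_def cylinder_def by (rule fl_image_closed_segment[OF nd def])
    have cN: "C Nu = closed_segment (nu - 2) m1"
      and cL: "C Lam = closed_segment m1 m2"
      and cM: "C Mu = closed_segment m2 (t - 2)"
      unfolding cyl fix_Nu fix_Mu glue_eta glue_xi m1_def m2_def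
      by (simp_all add: closed_segment_commute)
    \<comment> \<open>Each cut point gets two forms, so that every comparison of neighbours reduces
      to comparing \<open>c / s\<close> or \<open>c / (s + 1)\<close> at \<open>s = nu\<close> and
      \<open>s = t\<close>.\<close>
    have m1: "m1 = nu - 1 - nu / t" "m1 = mu * nu / (t + 1) - 1"
      using t glue_xi unfolding m1_def VS_dual_app by (simp_all add: field_simps)
    have m2: "m2 = mu - 1 - mu / (nu + 1)" "m2 = mu * nu / (nu + 1) - 1"
      using nu unfolding m2_def VS_dual_app by (simp_all add: field_simps)
    have tt: "t - 2 = mu - 1 - mu / (t + 1)"
      using fix_Mu t unfolding VS_dual_app by (simp add: field_simps)
    have nn2: "nu - 2 = nu - 1 - nu / nu" using nu by simp
    have order: "nu - 2 \<le> m1 \<and> m1 \<le> m2 \<and> m2 \<le> t - 2 \<or> t - 2 \<le> m2 \<and> m2 \<le> m1 \<and> m1 \<le> nu - 2"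
    proof (cases "nu \<le> t")
      case True
      have "nu / t \<le> nu / nu" "mu * nu / (t + 1) \<le> mu * nu / (nu + 1)" "mu / (t + 1) \<le> mu / (nu + 1)"
        using True mu nu t by (intro divide_left_mono; simp)+
      then show ?thesis using m1 m2 tt nn2 by linarith
    next
      case False
      have "nu / nu \<le> nu / t" "mu * nu / (nu + 1) \<le> mu * nu / (t + 1)" "mu / (nu + 1) \<le> mu / (t + 1)"
        using False mu nu t by (intro divide_left_mono; simp)+
      then show ?thesis using m1 m2 tt nn2 by linarith
    qed
    have "(\<Union>k. C k) = ?B"
      using order unfolding UNIV_branch
      by (auto simp: cN cL cM closed_segment_eq_real_ivl split: if_splits)
    moreover have "interior (C j)
        \<inter> interior (C k) = {}" if "j \<noteq> k" for j k
      using that order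
      by (cases j; cases k)
        (auto simp: cN cL cM closed_segment_eq_real_ivl interior_atLeastAtMost_real split: if_splits)
    moreover have "interior ?B \<noteq> {}"
      using False by (auto simp: closed_segment_eq_real_ivl interior_atLeastAtMost_real)
    moreover have "is_interval ?B" by (simp add: is_interval_convex_1)
    ultimately have "pfl_branches ?B (\<lambda>k. fl_adjoint (?V k))"
      unfolding pfl_branches_def C_def using nd def by blast
    then show ?thesis
      using pfl_map_exists nn unfolding has_exceptional_dual_def dual_map_def by blast
  qed
qed


section \<open>The invariant density\<close>

text \<open>With \<open>P\<close>, \<open>M\<close>, \<open>Q\<close> the values of \<open>1 + x y\<close> at three points \<open>y\<close>, this is the additivity of
  the integral of \<open>(1 + x y)\<^sup>-\<^sup>2\<close> divided by the total length, a form that survives when the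
  segment is a point.\<close>

lemma kernel_add:
  fixes P M Q w1 w2 :: real
  assumes "P \<noteq> 0" "M \<noteq> 0" "Q \<noteq> 0" and "(w1 + w2) * M = w2 * P + w1 * Q"
  shows "w1 / (P * M) + w2 / (M * Q) = (w1 + w2) / (P * Q)"
proof -
  have "w1 / (P * M) + w2 / (M * Q) = (w2 * P + w1 * Q) / (P * M * Q)"
    using assms by (simp add: field_simps)
  also have "\<dots> = (w1 + w2) / (P * Q)" using assms by (simp flip: assms(4))
  finally show ?thesis .
qed

text \<open>The adjoint satisfies \<open>(a + b x) (1 + p V x) = (a + c p) (1 + (V* p) x)\<close>.
  Using this for \<open>p\<close> and \<open>q\<close>, the squared denominator of the derivative
  cancels, and the kernel of the end points \<open>p\<close>, \<open>q\<close> becomes that of their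
  images.\<close>

lemma fl_kernel:
  assumes "a + b * x \<noteq> 0" and "u = fl_app (FL a c b d) p" and "v = fl_app (FL a c b d) q"
    and "a + c * p \<noteq> 0" and "a + c * q \<noteq> 0"
  shows "1 / ((1 + p * fl_app (FL a b c d) x) * (1 + q * fl_app (FL a b c d) x))
      * \<bar>deriv (fl_app (FL a b c d)) x\<bar>
    = \<bar>a * d - b * c\<bar> / ((a + c * p) * (a + c * q)) / ((1 + u * x) * (1 + v * x))"
proof -
  define N where "N = a + b * x"
  have N: "N \<noteq> 0" using assms(1) by (simp add: N_def)
  have *: "1 + p * fl_app (FL a b c d) x = (a + c * p) * (1 + fl_app (FL a c b d) p * x) / N"
    if "a + c * p \<noteq> 0" for p
  proof -
    have "1 + p * fl_app (FL a b c d) x = (N + p * (c + d * x)) / N"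
      using N by (simp add: field_simps flip: N_def)
    also have "N + p * (c + d * x) = (a + c * p) * (1 + fl_app (FL a c b d) p * x)"
      using that by (simp add: field_simps N_def)
    finally show ?thesis .
  qed
  show ?thesis
    unfolding *[OF assms(4)] *[OF assms(5)] fl_deriv[OF assms(1)] assms(2,3) N_def[symmetric]
    using N by (simp add: abs_divide power2_eq_square)
qed

lemma VS_invariant_density:
  assumes mu: "mu > 0" and nu: "nu \<ge> 1" and t: "t > 1" and t2: "t\<^sup>2 = 1 + mu * t" and C: "C > 0"
  shows "invariant_density (VS (mu * nu) mu nu)
    (\<lambda>x. C * (1 / ((1 + (nu - 2) * x) * (1 + (t - 2) * x))))"
proof -
  let ?V = "VS (mu * nu) mu nu"
  let ?h = "\<lambda>x. 1 / ((1 + (nu - 2) * x) * (1 + (t - 2) * x))"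
  have pos: "1 + (s - 2) * x > 0" if "s \<ge> 1" "0 < x" "x < 1" for s x :: real
  proof -
    have "1 + (s - 2) * x = (1 - x) + (s - 1) * x" by (simp add: algebra_simps)
    moreover have "(s - 1) * x \<ge> 0" using that by simp
    ultimately show ?thesis using that by linarith
  qed
  \<comment> \<open>Replacing \<open>mu\<close> turns the later identities into rational ones in
    \<open>t\<close> and \<open>nu\<close>.\<close>
  have mt: "mu = (t\<^sup>2 - 1) / t" using t t2 by (simp add: field_simps)
  have inv: "?h x = (\<Sum>k\<in>UNIV. ?h (fl_app (?V k) x) * \<bar>deriv (fl_app (?V k)) x\<bar>)"
    if x: "0 < x" "x < 1" for x
  proof -
    \<comment> \<open>These are the relative lengths of the pieces of \<open>Nu\<close>,
      \<open>Lam\<close>, \<open>Mu\<close>. The explicit formulas keep their meaning when the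
      segment is a point.\<close>
    define w1 w2 w3 where "w1 = 1 / t" and "w2 = nu * (t - 1) / ((nu + 1) * t)"
      and "w3 = (t - 1) / ((nu + 1) * t)"
    have w: "w1 + w2 + w3 = 1" "w1 \<ge> 0" "w2 \<ge> 0" "w3 \<ge> 0"
      using t nu unfolding w1_def w2_def w3_def by (simp_all add: divide_simps) (simp add: algebra_simps)
    define \<eta> \<xi> m1 m2 where "\<eta> = nu - 2" and "\<xi> = t - 2"
      and "m1 = nu - 1 - nu / t" and "m2 = mu * nu / (nu + 1) - 1"
    have m1: "m1 = \<eta> + w1 * (\<xi> - \<eta>)"
      using t unfolding m1_def \<eta>_def \<xi>_def w1_def by (simp add: field_simps)
    have m2: "m2 = \<xi> + w3 * (\<eta> - \<xi>)"
      using t nu unfolding m2_def \<eta>_def \<xi>_def w3_def mt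
      by (simp add: divide_simps) (simp add: algebra_simps power2_eq_square)
    define P Q M1 M2 where "P = 1 + \<eta> * x" and "Q = 1 + \<xi> * x"
      and "M1 = 1 + m1 * x" and "M2 = 1 + m2 * x"
    have P: "P > 0" and Q: "Q > 0"
      using pos[of nu x] pos[of t x] nu t x by (auto simp: P_def Q_def \<eta>_def \<xi>_def)
    \<comment> \<open>As \<open>1 + x y\<close> is affine in \<open>y\<close>, its values at the cut
      points are convex combinations of the positive end values.\<close>
    have M1: "M1 = (1 - w1) * P + w1 * Q" and M2: "M2 = w3 * P + (1 - w3) * Q"
      unfolding M1_def M2_def P_def Q_def m1 m2 by (simp_all add: algebra_simps)
    have w1: "0 < w1" "w1 < 1" using t by (simp_all add: w1_def)
    with w have w3: "0 \<le> w3" "w3 < 1" by linarith+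
    have "0 < M1" unfolding M1 using P Q w1 by (intro add_pos_pos mult_pos_pos) auto
    moreover have "0 < M2" unfolding M2 using P Q w3
      by (intro add_nonneg_pos mult_pos_pos mult_nonneg_nonneg) auto
    ultimately have ne: "P \<noteq> 0" "Q \<noteq> 0" "M1 \<noteq> 0" "M2 \<noteq> 0" using P Q by auto
    have w2: "w2 = 1 - w1 - w3" using w by simp
    have "w1 / (P * M1) + w2 / (M1 * M2) = (w1 + w2) / (P * M2)"
      by (rule kernel_add) (use ne in \<open>simp_all add: M1 M2 w2 algebra_simps\<close>)
    moreover have "(w1 + w2) / (P * M2) + w3 / (M2 * Q) = (w1 + w2 + w3) / (P * Q)"
      by (rule kernel_add) (use ne in \<open>simp_all add: M2 w2 algebra_simps\<close>)
    ultimately have sum: "w1 / (P * M1) + w2 / (M1 * M2) + w3 / (M2 * Q) = 1 / (P * Q)"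
      using w(1) by simp
    have d: "3 + (mu * nu - 3) * x \<noteq> 0" "3 + (2 * mu - 3) * x \<noteq> 0" "2 + (nu - 2) * x \<noteq> 0"
      using VS_denominators[of "mu * nu" mu nu x] mu nu x by auto
    have tn: "nu - 2 + 2 \<noteq> 0" "nu + 1 \<noteq> 0" "t \<noteq> 0" "t + 1 \<noteq> 0" using nu t by auto
    have N: "?h (fl_app (?V Nu) x) * \<bar>deriv (fl_app (?V Nu)) x\<bar> = w1 / (P * M1)"
    proof -
      have W: "w1 = \<bar>2 * (nu - 1) - (nu - 2) * 1\<bar> / ((2 + 1 * (nu - 2)) * (2 + 1 * (t - 2)))"
        using nu t unfolding w1_def by (simp add: field_simps)
      have UV: "\<eta> = fl_app (FL 2 1 (nu - 2) (nu - 1)) (nu - 2)"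
        "m1 = fl_app (FL 2 1 (nu - 2) (nu - 1)) (t - 2)"
        using nu t unfolding \<eta>_def m1_def by (simp_all add: field_simps)
      show ?thesis
        unfolding VS.simps P_def M1_def W by (rule fl_kernel[OF d(3) UV]) (use tn in simp_all)
    qed
    have L: "?h (fl_app (?V Lam) x) * \<bar>deriv (fl_app (?V Lam)) x\<bar> = w2 / (M1 * M2)"
    proof -
      have W: "w2 = \<bar>3 * (- 1) - (mu * nu - 3) * 1\<bar> / ((3 + 1 * (nu - 2)) * (3 + 1 * (t - 2)))"
      proof -
        have "w2 = mu * nu / ((nu + 1) * (t + 1))"
          unfolding w2_def mt using tn(2-4) by (simp add: divide_simps) (simp add: algebra_simps power2_eq_square)
        moreover have "mu * nu > 0" using mu nu by simp
        ultimately show ?thesis by (simp add: add.commute)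
      qed
      \<comment> \<open>The adjoint of the decreasing branch swaps the ends, so the factors
        \<open>M1\<close> and \<open>M2\<close> appear in reverse order.\<close>
      have UV: "m2 = fl_app (FL 3 1 (mu * nu - 3) (- 1)) (nu - 2)"
        "m1 = fl_app (FL 3 1 (mu * nu - 3) (- 1)) (t - 2)"
        using tn(2-4) unfolding m1_def m2_def mt
        by (simp_all add: divide_simps) (simp_all add: algebra_simps power2_eq_square)
      show ?thesis
        unfolding mult.commute[of M1] unfolding VS.simps M1_def M2_def W
        by (rule fl_kernel[OF d(1) UV]) (use tn in simp_all)
    qed
    have M: "?h (fl_app (?V Mu) x) * \<bar>deriv (fl_app (?V Mu)) x\<bar> = w3 / (M2 * Q)"
    proof -
      have W: "w3 = \<bar>3 * (mu - 1) - (2 * mu - 3) * 1\<bar> / ((3 + 1 * (nu - 2)) * (3 + 1 * (t - 2)))"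
      proof -
        have "w3 = mu / ((nu + 1) * (t + 1))"
          unfolding w3_def mt using tn(2-4) by (simp add: divide_simps) (simp add: algebra_simps power2_eq_square)
        then show ?thesis using mu by (simp add: add.commute)
      qed
      have UV: "m2 = fl_app (FL 3 1 (2 * mu - 3) (mu - 1)) (nu - 2)"
        "\<xi> = fl_app (FL 3 1 (2 * mu - 3) (mu - 1)) (t - 2)"
        using tn(2-4) unfolding \<xi>_def m2_def mt
        by (simp_all add: divide_simps) (simp_all add: algebra_simps power2_eq_square)
      show ?thesis
        unfolding VS.simps Q_def M2_def W by (rule fl_kernel[OF d(2) UV]) (use tn in simp_all)
    qed
    have branches: "(\<Sum>k\<in>UNIV. F k) = F Nu + F Lam + F Mu" for F :: "branch \<Rightarrow> real"
      by (simp add: UNIV_branch)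
    have "?h x = 1 / (P * Q)" by (simp add: P_def Q_def \<eta>_def \<xi>_def)
    also have "\<dots> = (\<Sum>k\<in>UNIV. ?h (fl_app (?V k) x) * \<bar>deriv (fl_app (?V k)) x\<bar>)"
      unfolding branches N L M sum ..
    finally show ?thesis .
  qed
  have "(\<lambda>x. C * ?h x) \<in> borel_measurable (restrict_space borel {0<..<1})"
    by (intro measurable_restrict_space1) measurable
  moreover have "C * ?h x > 0" if "x \<in> {0<..<1}" for x
    using that pos[of nu x] pos[of t x] nu t C by simp
  moreover have "C * ?h x = (\<Sum>k\<in>UNIV. C * ?h (fl_app (?V k) x) * \<bar>deriv (fl_app (?V k)) x\<bar>)"
    if "x \<in> {0<..<1}" for x
    using inv[of x] that unfolding mult.assoc sum_distrib_left[symmetric] by simp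
  ultimately show ?thesis unfolding invariant_density_def by blast
qed


section \<open>The one-step extension\<close>

text \<open>Take \<open>T\<close> with branches \<open>W False x = (1 - x) / (2 - x)\<close> and
  \<open>W True = V Nu\<close>. Then \<open>V Lam = W False o W True\<close> and
  \<open>V Mu = W False o W False\<close>, so \<open>T\<close> is iterated on
  \<open>{0..1/2}\<close>.\<close>

lemma VS_one_step_extension:
  assumes nu: "nu \<ge> 1" and S: "pfl_map {0..1} (VS nu 1 nu) S"
  shows "one_step_extension (VS nu 1 nu) S"
proof -
  let ?V = "VS nu 1 nu"
  define W where "W b = (if b then ?V Nu else FL 2 (- 1) 1 (- 1))" for b
  have pos: "0 < nu" "0 < (1 :: real)" using nu by auto
  note cyl = VS_cylinders[OF pos nu]
  have defF: "fl_defined (W False) x" if "x \<in> {0..1}" for x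
    using that by (simp add: W_def)
  have "fl_app (W False) ` {0..1} = {0..1/2}"
    using fl_image_closed_segment[of "W False" 0 1] defF
    by (simp add: closed_segment_eq_real_ivl W_def)
  then have cF: "cylinder {0..1} W False = {0..1/2}" by (simp add: cylinder_def)
  have cT: "cylinder {0..1} W True = {1/2..1}"
    using cyl(3) by (simp add: cylinder_def W_def)
  have "pfl_branches {0..1} W"
  proof -
    have "fl_nondegenerate (W k)" for k using nu by (cases k) (auto simp: W_def algebra_simps)
    moreover have "fl_defined (W k) x" if "x \<in> {0..1}" for k x
      using that defF VS_defined[OF pos nu, of x Nu] by (cases k) (auto simp: W_def)
    moreover have "(\<Union>k. cylinder {0..1} W k) = {0..1}" by (auto simp: UNIV_bool cF cT)
    moreover have "interior (cylinder {0..1} W j) \<inter> interior (cylinder {0..1} W k) = {}"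
      if "j \<noteq> k" for j k
      using that by (cases j; cases k) (auto simp: cF cT interior_atLeastAtMost_real)
    ultimately show ?thesis
      unfolding pfl_branches_def by (auto simp: interior_atLeastAtMost_real is_interval_cc)
  qed
  then obtain T where T: "pfl_map {0..1} W T" using pfl_map_exists by blast
  have TF: "T (fl_app (W False) y) = y" if "0 < y" "y < 1" for y
    by (rule pfl_map_branch[OF T])
      (use that in \<open>auto simp: cF interior_atLeastAtMost_real, simp_all add: W_def field_simps\<close>)
  have TT: "T (fl_app (W True) y) = y" and T_range: "1/2 < fl_app (W True) y" "fl_app (W True) y < 1"
    if "0 < y" "y < 1" for y
  proof -
    show *: "1/2 < fl_app (W True) y" "fl_app (W True) y < 1"
      using VS_monotone(3)[OF pos nu, of 0 y] VS_monotone(3)[OF pos nu, of y 1] that nu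
      by (simp_all add: W_def)
    show "T (fl_app (W True) y) = y"
      by (rule pfl_map_branch[OF T]) (use * that in \<open>auto simp: cT interior_atLeastAtMost_real\<close>)
  qed
  have eq: "S x = (if x \<in> cylinder {0..1} W False then T (T x) else T x)"
    if x: "x \<in> interior (cylinder {0..1} ?V k)" for x k
  proof -
    have "x \<in> cylinder {0..1} ?V k" using x interior_subset by blast
    then obtain y where y: "y \<in> {0..1}" "x = fl_app (?V k) y" unfolding cylinder_def by blast
    have Sx: "S x = y" using pfl_map_branch[OF S y(1)] x y(2) by simp
    \<comment> \<open>End points go to end points of cylinders, where \<open>T\<close> is not
      prescribed.\<close>
    have "y \<noteq> 0" "y \<noteq> 1"
      using x nu unfolding y(2) by (cases k; auto simp: cyl interior_atLeastAtMost_real)+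
    with y(1) have y01: "0 < y" "y < 1" by auto
    have d: "2 + (nu - 2) * y \<noteq> 0" "2 - y \<noteq> 0"
      using VS_denominators[OF pos nu, of y] y01 by auto
    show ?thesis
    proof (cases k)
      case Lam
      have "x = fl_app (W False) (fl_app (W True) y)"
        using d VS_denominators[OF pos nu, of y] y01
        by (simp add: y(2) Lam W_def divide_simps) (simp add: algebra_simps)
      moreover have "0 < fl_app (W True) y" using T_range(1)[OF y01] by linarith
      ultimately have "T (T x) = y" using TF[of "fl_app (W True) y"] TT[OF y01] T_range(2)[OF y01] by simp
      moreover have "x \<in> {0..1/2}" using x unfolding Lam by (auto simp: cyl interior_atLeastAtMost_real)
      ultimately show ?thesis unfolding cF using Sx by simp
    next
      case Mu
      have r: "0 < fl_app (W False) y" "fl_app (W False) y < 1"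
        using y01 by (simp_all add: W_def field_simps)
      have "x = fl_app (W False) (fl_app (W False) y)"
        using d y01 by (simp add: y(2) Mu W_def field_simps)
      then have "T (T x) = y" using TF[OF r] TF[OF y01] by simp
      moreover have "x \<in> {0..1/2}" using x unfolding Mu by (auto simp: cyl interior_atLeastAtMost_real)
      ultimately show ?thesis unfolding cF using Sx by simp
    next
      case Nu
      have "x = fl_app (W True) y" by (simp add: y(2) Nu W_def)
      then show ?thesis using Sx TT[OF y01] T_range[OF y01] by (simp add: cF)
    qed
  qed
  show ?thesis unfolding one_step_extension_def using S T cF cT eq by blast
qed

section \<open>From the coincidence conditions to the relations between the parameters\<close>

theorem theorem3:
  fixes lam mu nu \<eta> \<xi> :: real and S :: "real \<Rightarrow> real"
  assumes "lam > 0" and "mu > 0" and "nu \<ge> 1"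
    and "pfl_map {0..1} (VS lam mu nu) S"
    and "fl_app (VS_dual lam mu nu Nu) \<eta> = \<eta>"
    and "\<xi> = (mu - 4 + sqrt (mu\<^sup>2 + 4)) / 2"
    and "fl_app (VS_dual lam mu nu Lam) \<eta> = fl_app (VS_dual lam mu nu Mu) \<eta>"
    and "fl_app (VS_dual lam mu nu Lam) \<xi> = fl_app (VS_dual lam mu nu Nu) \<xi>"
  shows "(\<eta> = - 1 \<longrightarrow> lam = mu \<and> nu = 1) \<and>
    (\<eta> = nu - 2 \<longrightarrow> lam = mu * nu \<and>
       (mu = 1 \<longrightarrow> lam = nu \<and> one_step_extension (VS lam mu nu) S)) \<and>
    has_exceptional_dual (VS lam mu nu) \<and>
    (\<forall>C>0. invariant_density (VS lam mu nu)
       (\<lambda>x. C * (1 / ((1 + (nu - 2) * x) * (1 + \<xi> * x)))))"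
proof -
  define s t where "s = sqrt (mu\<^sup>2 + 4)" and "t = \<xi> + 2"
  have ts: "t = (mu + s) / 2" using assms(6) by (simp add: s_def t_def)
  have "s\<^sup>2 = mu\<^sup>2 + 4" by (simp add: s_def)
  then have t2: "t\<^sup>2 = 1 + mu * t" unfolding ts by (simp add: power2_eq_square field_simps)
  have "s > 0" using sum_power2_gt_zero_iff[of mu 2] by (simp add: s_def)
  then have t0: "t > 0" using assms(2) unfolding ts by simp
  then have "1\<^sup>2 < t\<^sup>2" unfolding t2 using assms(2) by simp
  then have t: "t > 1" by (rule power2_less_imp_less) (use t0 in simp)
  have xi: "\<xi> = t - 2" by (simp add: t_def)
  have lam: "lam = mu * nu"
  proof -
    \<comment> \<open>Cleared of denominators, the condition at \<open>xi\<close> is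
      \<open>lam t = nu (t^2 - 1)\<close>, and \<open>t^2 - 1 = mu t\<close>.\<close>
    have "(lam - 3 - (t - 2)) * t = (nu - 2 + (nu - 1) * (t - 2)) * (t + 1)"
      using assms(8) t unfolding xi VS_dual_app by (simp add: frac_eq_eq add.commute)
    then have "lam * t = nu * (t\<^sup>2 - 1)" by (simp add: power2_eq_square algebra_simps)
    then show ?thesis using t t2 by simp
  qed
  have "lam = mu \<and> nu = 1" if "\<eta> = - 1"
  proof -
    \<comment> \<open>At -1 both denominators are 2 and the numerators are \<open>lam - 2\<close>
      and \<open>mu - 2\<close>.\<close>
    have "lam = mu" using assms(7) unfolding that VS_dual_app by simp
    with lam assms(2) show ?thesis by simp
  qed
  moreover have "lam = nu \<and> one_step_extension (VS lam mu nu) S" if "mu = 1"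
    using VS_one_step_extension[OF assms(3)] assms(4) that lam by simp
  moreover have "has_exceptional_dual (VS lam mu nu)"
    unfolding lam by (rule VS_exceptional_dual[OF assms(2,3) t t2])
  moreover have "invariant_density (VS lam mu nu)
      (\<lambda>x. C * (1 / ((1 + (nu - 2) * x) * (1 + \<xi> * x))))" if "C > 0" for C
    unfolding lam xi by (rule VS_invariant_density[OF assms(2,3) t t2 that])
  ultimately show ?thesis using lam by blast
qed

end
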